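(* Let $m \neq \ell$ with $0\le m,\ell\le n-2$. Then $$ \sum_{\pi \in \mathrm{PPF}_n} q^{ \Delta_{\ell} f(\pi)} F_{n, \mathrm{Set}_{\ell}(\pi)}=\sum_{i=1}^n q^{n-i}(n-2)^{i-1} s_{(i,1^{n-i})},$$ and $$ \sum_{\pi \in \mathrm{PPF}_n} q^{ \Delta_{\ell} f(\pi)} F_{n, \mathrm{Set}_{m}(\pi)}= \sum_{i=1}^n (q+n-3)^{i-1} s_{(i,1^{n-i})}.$$
   Context: A (classical) parking function of length $n$ is a sequence of positive integers whose increasing rearrangement $\lambda$ satisfies $\lambda_i\le i$. A parking function of length $n$ is prime if removing any instance of 1 yields a parking function of length $n-1$; $\mathrm{PPF}_n$ denotes this set. A tuple $(x_1,\dots,x_n)$ has an $\ell$-forward difference at $i\in[n-1]$ if $x_{i+1}-x_i\equiv\ell\pmod{n-1}$; $\Delta_\ell f(\pi)$ is the number of $\ell$-forward differences of $\pi$, and $\mathrm{Set}_\ell(\pi)\subseteq[n-1]$ is the set of indices $i$ at which $\pi$ has an $\ell$-forward difference. For $S\subseteq[n-1]$, $F_{n,S}=\sum_{1\le b_1\le\cdots\le b_n,\ i\in S\Rightarrow b_i<b_{i+1}} x_{b_1}\cdots x_{b_n}$ is Gessel's fundamental quasisymmetric function, and $s_{(i,1^{n-i})}$ is the Schur function of the hook partition $(i,1^{n-i})$. *)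

theory Defs
  imports Complex_Main "HOL-Library.Multiset" "HOL-Library.Function_Algebras"
    "HOL-Number_Theory.Cong" "HOL-Computational_Algebra.Polynomial"
begin

definition parking_function :: "nat \<Rightarrow> nat list \<Rightarrow> bool" where
  "parking_function n xs \<longleftrightarrow>
     length xs = n \<and> (\<forall>x \<in> set xs. 1 \<le> x) \<and> (\<forall>i \<in> {1..n}. sort xs ! (i - 1) \<le> i)"

definition prime_parking_function :: "nat \<Rightarrow> nat list \<Rightarrow> bool" where
  "prime_parking_function n xs \<longleftrightarrow>
     parking_function n xs \<and>
     (\<forall>i < n. xs ! i = 1 \<longrightarrow> parking_function (n - 1) (take i xs @ drop (Suc i) xs))"

definition PPF :: "nat \<Rightarrow> nat list set" where
  "PPF n = {xs. prime_parking_function n xs}"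

text \<open>Positions are numbered from 1, so the entry \<open>x\<^sub>i\<close> of a tuple is \<open>xs ! (i - 1)\<close>.\<close>

definition fdiff_set :: "int \<Rightarrow> nat list \<Rightarrow> nat set" where
  "fdiff_set l xs =
     {i \<in> {1..length xs - 1}. [int (xs ! i) - int (xs ! (i - 1)) = l] (mod (int (length xs) - 1))}"

definition fdiff :: "int \<Rightarrow> nat list \<Rightarrow> nat" where
  "fdiff l xs = card (fdiff_set l xs)"

text \<open>
  A formal power series in the variables \<open>x\<^sub>1, x\<^sub>2, \<dots>\<close> is given by its coefficients; the monomial
  \<open>x\<^bsub>b\<^sub>1\<^esub> \<cdots> x\<^bsub>b\<^sub>n\<^esub>\<close> is the multiset of its indices. Addition is the
  pointwise one of functions (the pointwise product of functions is not the product of series,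
  and is not used).
\<close>

type_synonym 'a series = "nat multiset \<Rightarrow> 'a"

definition scale :: "'a::times \<Rightarrow> 'a series \<Rightarrow> 'a series"  (infixr "*\<^sub>S" 75) where
  "c *\<^sub>S f = (\<lambda>M. c * f M)"

text \<open>
  The series \<open>\<Sum>b \<in> B. wt b\<close> of monomials; only meaningful if every monomial is the weight of
  finitely many elements of \<open>B\<close>.
\<close>

definition gen_series :: "'b set \<Rightarrow> ('b \<Rightarrow> nat multiset) \<Rightarrow> 'a::semiring_1 series" where
  "gen_series B wt = (\<lambda>M. of_nat (card {b \<in> B. wt b = M}))"

definition fundamental_qsym :: "nat \<Rightarrow> nat set \<Rightarrow> 'a::semiring_1 series" where
  "fundamental_qsym n S =
     gen_series {b. length b = n \<and> (\<forall>x \<in> set b. 1 \<le> x) \<and> sorted b \<and>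
                    (\<forall>i \<in> S \<inter> {1..n - 1}. b ! (i - 1) < b ! i)} mset"

text \<open>
  Partitions are weakly decreasing lists of positive integers; rows and columns of Young diagrams
  are numbered from 0. Tableaux are zero outside their diagram so that each is counted once.
\<close>

definition young_diagram :: "nat list \<Rightarrow> (nat \<times> nat) set" where
  "young_diagram p = {(r, c). r < length p \<and> c < p ! r}"

definition ssyt :: "nat list \<Rightarrow> (nat \<times> nat \<Rightarrow> nat) set" where
  "ssyt p =
     {T. (\<forall>u \<in> young_diagram p. 1 \<le> T u) \<and> (\<forall>u. u \<notin> young_diagram p \<longrightarrow> T u = 0) \<and>
         (\<forall>r c c'. c < c' \<and> (r, c') \<in> young_diagram p \<longrightarrow> T (r, c) \<le> T (r, c')) \<and>
         (\<forall>r r' c. r < r' \<and> (r', c) \<in> young_diagram p \<longrightarrow> T (r, c) < T (r', c))}"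

definition schur :: "nat list \<Rightarrow> 'a::semiring_1 series" where
  "schur p = gen_series (ssyt p) (\<lambda>T. image_mset T (mset_set (young_diagram p)))"

definition hook :: "nat \<Rightarrow> nat \<Rightarrow> nat list" where
  "hook n i = i # replicate (n - i) 1"

text \<open>The indeterminate \<open>q\<close> of the coefficient ring \<open>\<int>[q]\<close>.\<close>

definition qvar :: "int poly" where
  "qvar = [:0, 1:]"

text \<open>The sets that are summed over, or whose elements are counted, are all finite.\<close>

lemma finite_PPF: "finite (PPF n)"
proof (rule finite_subset)
  show "PPF n \<subseteq> {xs. set xs \<subseteq> {..n} \<and> length xs = n}"
  proof
    fix xs assume "xs \<in> PPF n"
    then have l: "length xs = n" and b: "\<forall>i \<in> {1..n}. sort xs ! (i - 1) \<le> i"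
      by (auto simp: PPF_def prime_parking_function_def parking_function_def)
    have "x \<le> n" if "x \<in> set xs" for x
    proof -
      from that have "x \<in> set (sort xs)" by simp
      then obtain j where "j < n" "sort xs ! j = x"
        using l by (metis in_set_conv_nth length_sort)
      with b[rule_format, of "Suc j"] show ?thesis by simp
    qed
    with l show "xs \<in> {xs. set xs \<subseteq> {..n} \<and> length xs = n}" by auto
  qed
qed (rule finite_lists_length_eq, simp)

lemma finite_words_mset: "finite {b \<in> B. mset b = M}"
  by (rule finite_subset[OF _ finite_lists_length_eq[of "set_mset M" "size M"]]) auto

lemma finite_young_diagram: "finite (young_diagram p)"
proof -
  have "young_diagram p = (SIGMA r:{..<length p}. {..<p ! r})"
    by (auto simp: young_diagram_def)
  then show ?thesis by simp
qed

lemma finite_ssyt_weight: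
  "finite {T \<in> ssyt p. image_mset T (mset_set (young_diagram p)) = M}"
proof (rule finite_subset)
  show "{T \<in> ssyt p. image_mset T (mset_set (young_diagram p)) = M} \<subseteq>
        {T. \<forall>u. (u \<in> young_diagram p \<longrightarrow> T u \<in> set_mset M) \<and> (u \<notin> young_diagram p \<longrightarrow> T u = 0)}"
    using finite_young_diagram[of p] by (auto simp: ssyt_def)
  show "finite {T. \<forall>u. (u \<in> young_diagram p \<longrightarrow> T u \<in> set_mset M) \<and>
                        (u \<notin> young_diagram p \<longrightarrow> T u = 0)}"
    by (rule finite_set_of_finite_funs) (simp_all add: finite_young_diagram)
qed

end

theory Submission
  imports Defs "HOL-Library.FuncSet"
begin

text \<open>
  Put \<open>N = n - 1\<close>. By the cycle lemma every word of length \<open>n\<close> over \<open>\<int>/N\<close> has exactly one translate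
  that is a prime parking function, so prime parking functions correspond to arbitrary vectors of
  \<open>N\<close> differences modulo \<open>N\<close>. Each difference can therefore be chosen independently, and both
  sums take the form \<open>\<Sum>S. \<alpha>^|S| \<beta>^(N-|S|) F\<^bsub>n,S\<^esub>\<close>. Finally, the sum of \<open>F\<^bsub>n,S\<^esub>\<close> over
  \<open>|S| = n - i\<close> is the hook Schur function: if a monomial involves \<open>k\<close> distinct variables, its
  coefficient on both sides is \<open>k - 1\<close> choose \<open>n - i\<close>, because a hook tableau is determined by the
  entries of its first column below the corner.
\<close>

subsection \<open>Prime parking functions as difference vectors\<close>

text \<open>The walk \<open>h\<close> of partial sums minus the number of steps rises by exactly 1
  over each period. The condition on \<open>c\<close> says that \<open>h\<close> stays strictly
  above \<open>h c\<close> during the next \<open>N\<close> steps.\<close>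

lemma cycle_lemma:
  fixes a :: "nat \<Rightarrow> int"
  assumes N: "N > 0" and periodic: "\<And>t. a (t + N) = a t"
    and total: "(\<Sum>t<N. a t) = int N + 1"
  shows "\<exists>!c. c < N \<and> (\<forall>k\<in>{1..N}. int k < (\<Sum>t\<in>{c..<c + k}. a t))"
proof -
  define h where "h k = (\<Sum>t<k. a t) - int k" for k
  have window: "(\<Sum>t\<in>{c..<c + k}. a t) = h (c + k) - h c + int k" for c k
  proof -
    have "(\<Sum>t<c + k. a t) = (\<Sum>t<c. a t) + (\<Sum>t\<in>{c..<c + k}. a t)"
      by (metis atLeast0LessThan le_add1 sum.atLeastLessThan_concat zero_le)
    then show ?thesis by (simp add: h_def)
  qed
  have h_shift: "h (t + N) = h t + 1" for t
  proof (induction t)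
    case 0
    show ?case using total by (simp add: h_def)
  next
    case (Suc t)
    then show ?case using periodic[of t] by (simp add: h_def)
  qed
  let ?P = "\<lambda>c. \<forall>k\<in>{1..N}. h c < h (c + k)"
  \<comment> \<open>The good starting point is the last position in a period at which \<open>h\<close> attains its minimum.\<close>
  have "\<exists>c<N. ?P c"
  proof -
    define \<mu> where "\<mu> = Min (h ` {..<N})"
    define c where "c = Max {t\<in>{..<N}. h t = \<mu>}"
    have min: "\<mu> \<le> h t" if "t < N" for t
      using that by (auto simp: \<mu>_def)
    have "\<mu> \<in> h ` {..<N}"
      unfolding \<mu>_def using N by (intro Min_in) auto
    then have "c \<in> {t\<in>{..<N}. h t = \<mu>}"
      unfolding c_def by (intro Max_in) auto
    then have c: "c < N" "h c = \<mu>" by auto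
    have last: "\<mu> < h t" if "t < N" "c < t" for t
    proof -
      have "h t \<noteq> \<mu>"
      proof
        assume "h t = \<mu>"
        then have "t \<le> c" unfolding c_def using that by (intro Max_ge) auto
        with that show False by simp
      qed
      with min[OF that(1)] show ?thesis by simp
    qed
    have "?P c"
    proof
      fix k assume k: "k \<in> {1..N}"
      show "h c < h (c + k)"
      proof (cases "c + k < N")
        case True
        then show ?thesis using last[of "c + k"] c k by simp
      next
        \<comment> \<open>Here the position lies beyond the first period, where \<open>h\<close> is
          one more than a value in that period, hence more than \<mu>.\<close>
        case False
        then have "h (c + k) = h (c + k - N) + 1"
          using h_shift[of "c + k - N"] by simp
        moreover have "\<mu> \<le> h (c + k - N)"
          using k c by (intro min) auto
        ultimately show ?thesis using c by simp
      qed
    qed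
    with c show ?thesis by blast
  qed
  moreover have False if "?P c" "?P c'" "c < c'" "c' < N" for c c'
  proof -
    \<comment> \<open>Two good starts would place \<open>h c'\<close> strictly between
      \<open>h c\<close> and \<open>h (c + N) = h c + 1\<close>, where there is no integer.\<close>
    have "c' - c \<in> {1..N}" "c + N - c' \<in> {1..N}" using that by auto
    then have "h c < h (c + (c' - c))" "h c' < h (c' + (c + N - c'))"
      using that by blast+
    then have "h c < h c'" "h c' < h (c + N)" using that by simp_all
    then show False using h_shift[of c] by simp
  qed
  ultimately have "\<exists>!c. c < N \<and> ?P c"
    by (metis linorder_neqE_nat)
  then show ?thesis by (simp add: window)
qed

section \<open>Parking conditions as counts of small entries\<close>

lemma sorted_nth_le_iff_length_filter:
  fixes ys :: "'a::linorder list"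
  assumes "sorted ys" "k < length ys"
  shows "ys ! k \<le> v \<longleftrightarrow> k < length (filter (\<lambda>x. x \<le> v) ys)"
  using assms
proof (induction ys arbitrary: k)
  case (Cons y ys)
  show ?case
  proof (cases "y \<le> v")
    case True
    then show ?thesis using Cons by (cases k) auto
  next
    case False
    then have "filter (\<lambda>x. x \<le> v) (y # ys) = []"
      using Cons.prems by (force simp: filter_empty_conv)
    moreover have "v < (y # ys) ! k"
    proof -
      have "(y # ys) ! k \<in> set (y # ys)" using Cons.prems(2) by (rule nth_mem)
      then show ?thesis using False Cons.prems(1) by auto
    qed
    ultimately show ?thesis by simp
  qed
qed simp

text \<open>Counts ignore the order of the entries and change predictably when an entry is deleted,
  so this form replaces sorting from here on.\<close>

lemma parking_function_iff_length_filter: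
  "parking_function n xs \<longleftrightarrow> length xs = n \<and> (\<forall>x\<in>set xs. 1 \<le> x) \<and>
     (\<forall>k\<in>{1..n}. k \<le> length (filter (\<lambda>x. x \<le> k) xs))"
proof -
  have "sort xs ! (k - 1) \<le> k \<longleftrightarrow> k \<le> length (filter (\<lambda>x. x \<le> k) xs)"
    if "length xs = n" "k \<in> {1..n}" for k
  proof -
    have "length (filter (\<lambda>x. x \<le> k) (sort xs)) = length (filter (\<lambda>x. x \<le> k) xs)"
      by (metis mset_filter mset_sort size_mset)
    then show ?thesis
      using sorted_nth_le_iff_length_filter[of "sort xs" "k - 1" k] that
      by (simp add: Suc_le_lessD less_eq_Suc_le)
  qed
  then show ?thesis unfolding parking_function_def by blast
qed

text \<open>Deleting a 1 lowers each count of entries at most \<open>k\<close>, for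
  \<open>k \<ge> 1\<close>, by exactly one, so the parking condition on the shorter word is the
  strict inequality on the original. At \<open>k = n - 1\<close> it forces all \<open>n\<close>
  entries to be at most \<open>n - 1\<close>, so that letters can be read as residues modulo
  \<open>n - 1\<close>.\<close>

lemma PPF_iff_length_filter:
  assumes "n \<ge> 2"
  shows "xs \<in> PPF n \<longleftrightarrow> length xs = n \<and> set xs \<subseteq> {1..n - 1} \<and>
     (\<forall>k\<in>{1..n - 1}. k < length (filter (\<lambda>x. x \<le> k) xs))" (is "_ \<longleftrightarrow> ?R")
proof -
  have removed: "length (filter (\<lambda>x. x \<le> k) xs) =
      Suc (length (filter (\<lambda>x. x \<le> k) (take i xs @ drop (Suc i) xs)))"
    if "i < length xs" "xs ! i = 1" "k \<ge> 1" for i k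
  proof -
    have "xs = take i xs @ 1 # drop (Suc i) xs"
      using that id_take_nth_drop by metis
    then have "length (filter (\<lambda>x. x \<le> k) xs) =
        length (filter (\<lambda>x. x \<le> k) (take i xs @ 1 # drop (Suc i) xs))" by simp
    then show ?thesis using that by simp
  qed
  show ?thesis
  proof
    assume "xs \<in> PPF n"
    then have pf: "parking_function n xs"
      and prime: "\<And>i. i < n \<Longrightarrow> xs ! i = 1 \<Longrightarrow>
        parking_function (n - 1) (take i xs @ drop (Suc i) xs)"
      by (auto simp: PPF_def prime_parking_function_def)
    have len: "length xs = n" and pos: "\<forall>x\<in>set xs. 1 \<le> x"
      using pf by (auto simp: parking_function_iff_length_filter)
    \<comment> \<open>Primality speaks only about occurrences of 1, so one must first be found; the
      count at \<open>k = 1\<close> supplies it.\<close>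
    have "1 \<le> length (filter (\<lambda>x. x \<le> 1) xs)"
      using pf assms unfolding parking_function_iff_length_filter by force
    then have "filter (\<lambda>x. x \<le> 1) xs \<noteq> []" by auto
    then obtain x where "x \<in> set xs" "x \<le> 1"
      by (auto simp: filter_empty_conv)
    with pos len obtain i where i: "i < n" "xs ! i = 1"
      by (metis in_set_conv_nth le_antisym)
    have cnt: "\<forall>k\<in>{1..n - 1}. k < length (filter (\<lambda>x. x \<le> k) xs)"
      using prime[OF i] removed[of i] i len by (auto simp: parking_function_iff_length_filter)
    then have "n - 1 < length (filter (\<lambda>x. x \<le> n - 1) xs)"
      using assms by auto
    then have "length (filter (\<lambda>x. x \<le> n - 1) xs) = length xs"
      using length_filter_le[of "\<lambda>x. x \<le> n - 1" xs] len by linarith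
    then have "\<forall>x\<in>set xs. x \<le> n - 1"
      by (metis length_filter_less less_irrefl)
    with cnt pos len show ?R by auto
  next
    assume R: ?R
    have "filter (\<lambda>x. x \<le> n) xs = xs"
      using R by (force simp: filter_id_conv)
    moreover have "k \<le> length (filter (\<lambda>x. x \<le> k) xs)" if "k \<in> {1..n - 1}" for k
      using R that by (simp add: less_imp_le)
    ultimately have "k \<le> length (filter (\<lambda>x. x \<le> k) xs)" if "k \<in> {1..n}" for k
      using R that by (cases "k = n") auto
    then have "parking_function n xs"
      using R by (auto simp: parking_function_iff_length_filter)
    moreover have "parking_function (n - 1) (take i xs @ drop (Suc i) xs)"
      if "i < n" "xs ! i = 1" for i
      using R that removed[of i]
      by (force simp: parking_function_iff_length_filter dest: in_set_takeD in_set_dropD)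
    ultimately show "xs \<in> PPF n"
      by (simp add: PPF_def prime_parking_function_def)
  qed
qed

text \<open>Adding \<open>N - c\<close> subtracts \<open>c\<close> modulo \<open>N\<close> without
  leaving the naturals. It rotates the residue of \<open>c\<close> to 0, so results below
  \<open>k\<close> come from the cyclic window of \<open>k\<close> residues starting at
  \<open>c\<close>.\<close>

lemma card_residues_in_window:
  fixes r :: "'a \<Rightarrow> nat"
  assumes "finite J" "c \<le> N" "k \<le> N"
  shows "card {j\<in>J. (r j + (N - c)) mod N < k} =
    (\<Sum>t\<in>{c..<c + k}. card {j\<in>J. r j mod N = t mod N})"
proof -
  have "(x + (N - c)) mod N < k \<longleftrightarrow> (\<exists>t\<in>{c..<c + k}. x mod N = t mod N)" for x
  proof
    assume "(x + (N - c)) mod N < k"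
    moreover have "(c + (x + (N - c)) mod N) mod N = x mod N"
      using assms by (simp add: mod_add_right_eq)
    ultimately show "\<exists>t\<in>{c..<c + k}. x mod N = t mod N"
      by (intro bexI[of _ "c + (x + (N - c)) mod N"]) auto
  next
    assume "\<exists>t\<in>{c..<c + k}. x mod N = t mod N"
    then obtain t where t: "c \<le> t" "t < c + k" "x mod N = t mod N" by auto
    have "(x + (N - c)) mod N = (t + (N - c)) mod N"
      using t by (metis mod_add_left_eq)
    also have "\<dots> = (t - c) mod N" using t assms by (metis Nat.add_diff_assoc
      Nat.add_diff_assoc2 mod_add_self2)
    also have "\<dots> = t - c" using t assms by simp
    finally show "(x + (N - c)) mod N < k" using t by simp
  qed
  then have "{j\<in>J. (r j + (N - c)) mod N < k} =
      (\<Union>t\<in>{c..<c + k}. {j\<in>J. r j mod N = t mod N})" by auto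
  \<comment> \<open>At most \<open>N\<close> consecutive numbers meet each residue class at most
    once, so the union is disjoint and the cardinalities add.\<close>
  moreover have "t = t'" if "t \<in> {c..<c + k}" "t' \<in> {c..<c + k}" "t mod N = t' mod N" for t t'
  proof -
    have "t = t'" if "t mod N = t' mod N" "t \<le> t'" "t' < t + N" for t t' :: nat
    proof -
      have "N dvd t' - t" using that by (metis mod_eq_dvd_iff_nat)
      then show ?thesis using that
        by (metis diff_is_0_eq less_diff_conv2 nat_dvd_not_less neq0_conv add.commute le_antisym)
    qed
    from this[of t t'] this[of t' t] that assms show ?thesis by (cases "t \<le> t'") auto
  qed
  ultimately show ?thesis
    using assms by (simp add: card_UN_disjoint disjoint_iff) (subst card_UN_disjoint; force)
qed

text \<open>With \<open>a t\<close> the number of letters of residue \<open>t\<close>, the count of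
  entries at most \<open>k\<close> in a translate is the sum of \<open>a\<close> over a window. The
  counting criterion for \<open>PPF\<close> thus becomes the condition of the cycle lemma.\<close>

lemma ex1_shift_PPF:
  fixes r :: "nat \<Rightarrow> nat"
  assumes "N > 0"
  shows "\<exists>!c. c < N \<and> map (\<lambda>j. (r j + (N - c)) mod N + 1) [0..<Suc N] \<in> PPF (Suc N)"
proof -
  define a where "a t = int (card {j\<in>{..<Suc N}. r j mod N = t mod N})" for t
  let ?w = "\<lambda>c. map (\<lambda>j. (r j + (N - c)) mod N + 1) [0..<Suc N]"
  have count: "int (length (filter (\<lambda>x. x \<le> k) (?w c))) = (\<Sum>t\<in>{c..<c + k}. a t)"
    if "c < N" "k \<le> N" for c k
  proof -
    have "length (filter (\<lambda>x. x \<le> k) (?w c)) = card {j\<in>{..<Suc N}. (r j + (N - c)) mod N < k}"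
      by (auto simp: length_filter_conv_card Suc_le_eq nth_append simp del: upt_Suc
          intro!: arg_cong[where f = card])
    also have "\<dots> = (\<Sum>t\<in>{c..<c + k}. card {j\<in>{..<Suc N}. r j mod N = t mod N})"
      using that by (intro card_residues_in_window) auto
    finally show ?thesis by (simp add: a_def)
  qed
  \<comment> \<open>The full window counts each of the \<open>N + 1\<close> letters; this is the
    surplus of one that the cycle lemma asks for.\<close>
  have "(\<Sum>t<N. a t) = int N + 1"
    using count[of 0 N] assms by (simp add: atLeast0LessThan Suc_le_eq del: upt_Suc)
  then have "\<exists>!c. c < N \<and> (\<forall>k\<in>{1..N}. int k < (\<Sum>t\<in>{c..<c + k}. a t))"
    using assms by (intro cycle_lemma) (auto simp: a_def)
  moreover have "?w c \<in> PPF (Suc N) \<longleftrightarrow> (\<forall>k\<in>{1..N}. int k < (\<Sum>t\<in>{c..<c + k}. a t))"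
    if "c < N" for c
  proof -
    have "?w c \<in> PPF (Suc N) \<longleftrightarrow> (\<forall>k\<in>{1..N}. k < length (filter (\<lambda>x. x \<le> k) (?w c)))"
      using assms by (subst PPF_iff_length_filter) (auto simp: Suc_le_eq simp del: upt_Suc)
    then show ?thesis using count[OF that] by (metis atLeastAtMost_iff of_nat_less_iff)
  qed
  then have "c < N \<and> ?w c \<in> PPF (Suc N) \<longleftrightarrow>
      c < N \<and> (\<forall>k\<in>{1..N}. int k < (\<Sum>t\<in>{c..<c + k}. a t))" for c
    by blast
  ultimately show ?thesis by (simp only:)
qed

text \<open>Consecutive differences modulo \<open>N\<close> determine a word up to translation, and
  exactly one translate is a prime parking function.\<close>

lemma bij_betw_PPF_differences:
  assumes "N > 0"
  shows "bij_betw (\<lambda>xs. \<lambda>i\<in>{1..N}. (int (xs ! i) - int (xs ! (i - 1))) mod int N)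
    (PPF (Suc N)) ({1..N} \<rightarrow>\<^sub>E {0..<int N})" (is "bij_betw ?\<delta> _ _")
proof (rule bij_betw_imageI)
  let ?w = "\<lambda>r c. map (\<lambda>j. (r j + (N - c)) mod N + 1) [0..<Suc N]"
  have residue: "int ((x + (N - c)) mod N) = (int x - int c) mod int N" if "c < N" for x c
    using that by (simp add: zmod_int of_nat_diff) (metis add_diff_eq diff_add_eq mod_add_self2)
  show "inj_on ?\<delta> (PPF (Suc N))"
  proof
    fix xs ys assume xs: "xs \<in> PPF (Suc N)" and ys: "ys \<in> PPF (Suc N)" and eq: "?\<delta> xs = ?\<delta> ys"
    define r where "r j = xs ! j - 1" for j
    \<comment> \<open>The amount by which \<open>xs\<close> must be shifted down to give
      \<open>ys\<close>, read off from the first entries; it will turn out to be 0.\<close>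
    define c where "c = nat ((int (xs ! 0) - int (ys ! 0)) mod int N)"
    have c: "c < N" "int c = (int (xs ! 0) - int (ys ! 0)) mod int N"
      using assms by (simp_all add: c_def nat_less_iff)
    have range: "length zs = Suc N" "\<And>j. j < Suc N \<Longrightarrow> 1 \<le> zs ! j \<and> zs ! j \<le> N"
      if "zs \<in> PPF (Suc N)" for zs
    proof -
      have "length zs = Suc N" "set zs \<subseteq> {1..N}"
        using that assms by (simp_all add: PPF_iff_length_filter)
      then show "length zs = Suc N" by simp
      show "1 \<le> zs ! j \<and> zs ! j \<le> N" if "j < Suc N" for j
        using nth_mem[of j zs] that \<open>length zs = Suc N\<close> \<open>set zs \<subseteq> {1..N}\<close>
        by (auto dest!: subsetD)
    qed
    have offset: "[int (ys ! j) = int (xs ! j) - int c] (mod int N)" if "j < Suc N" for j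
      using that
    proof (induction j)
      case 0
      show ?case by (simp add: c cong_def mod_diff_right_eq)
    next
      case (Suc j)
      have "[int (xs ! Suc j) - int (xs ! j) = int (ys ! Suc j) - int (ys ! j)] (mod int N)"
        using fun_cong[OF eq, of "Suc j"] Suc.prems by (simp add: cong_def)
      from cong_add[OF cong_sym[OF this] Suc.IH] Suc.prems show ?case
        by (simp add: algebra_simps)
    qed
    have "ys = ?w r c"
    proof (rule nth_equalityI)
      fix j assume "j < length ys"
      then have j: "j < Suc N" using range[OF ys] by simp
      have "int (ys ! j - 1) = int (ys ! j - 1) mod int N"
        using range(2)[OF ys j] assms by simp
      also have "\<dots> = (int (r j) - int c) mod int N"
        using cong_diff[OF offset[OF j] cong_refl[of 1]] range(2)[OF ys j] range(2)[OF xs j]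
        by (simp add: cong_def r_def of_nat_diff algebra_simps)
      also have "\<dots> = int ((r j + (N - c)) mod N)" using residue[OF c(1)] by simp
      finally have "ys ! j - 1 = (r j + (N - c)) mod N" by (simp only: of_nat_eq_iff)
      then have "ys ! j = (r j + (N - c)) mod N + 1" using range(2)[OF ys j] by linarith
      then show "ys ! j = ?w r c ! j" using j by (simp del: upt_Suc)
    qed (simp add: range[OF ys])
    moreover have "xs = ?w r 0"
    proof (rule nth_equalityI)
      fix j assume "j < length xs"
      then have j: "j < Suc N" using range[OF xs] by simp
      have "r j mod N = r j" "r j + 1 = xs ! j" using range(2)[OF xs j] by (auto simp: r_def)
      then show "xs ! j = ?w r 0 ! j" using j by (simp del: upt_Suc)
    qed (simp add: range[OF xs])
    \<comment> \<open>Both words are translates of the same \<open>r\<close> and lie in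
      \<open>PPF\<close>, so uniqueness of the shift applies.\<close>
    ultimately have "c = 0"
      using ex1_shift_PPF[OF assms, of r] xs ys c(1) assms by metis
    then show "xs = ys" using \<open>ys = ?w r c\<close> \<open>xs = ?w r 0\<close> by metis
  qed
  show "?\<delta> ` PPF (Suc N) = {1..N} \<rightarrow>\<^sub>E {0..<int N}"
  proof (intro equalityI subsetI)
    fix d assume d: "d \<in> {1..N} \<rightarrow>\<^sub>E {0..<int N}"
    \<comment> \<open>Partial sums of \<open>d\<close> give a word with the prescribed differences;
      \<open>nat\<close> loses nothing because \<open>d\<close> is nonnegative on
      \<open>{1..N}\<close>.\<close>
    define r where "r j = nat (\<Sum>i\<in>{1..j}. d i)" for j
    have r: "int (r j) = (\<Sum>i\<in>{1..j}. d i)" if "j \<le> N" for j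
      unfolding r_def using d that by (force intro: sum_nonneg simp: PiE_iff)
    obtain c where c: "c < N" and w: "?w r c \<in> PPF (Suc N)"
      using ex1_shift_PPF[OF assms] by blast
    have \<delta>_w: "?\<delta> (?w r c) = d"
    proof (rule extensionalityI)
      fix i assume i: "i \<in> {1..N}"
      have "?\<delta> (?w r c) i =
          ((int (r i) - int c) mod int N - (int (r (i - 1)) - int c) mod int N) mod int N"
      proof -
        have "i < Suc N" "i - 1 < Suc N" using i by auto
        then show ?thesis using i by (simp add: residue[OF c] del: upt_Suc)
      qed
      also have "\<dots> = (int (r i) - int (r (i - 1))) mod int N"
        by (simp add: mod_diff_eq)
      also have "int (r i) - int (r (i - 1)) = d i"
        using i by (cases i) (auto simp: r)
      also have "d i mod int N = d i" using d i by (auto simp: PiE_iff)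
      finally show "?\<delta> (?w r c) i = d i" .
    qed (use d in \<open>auto simp: PiE_iff\<close>)
    show "d \<in> ?\<delta> ` PPF (Suc N)" 
      by (rule image_eqI[where x = "?w r c"]) (use \<delta>_w w in \<open>simp_all del: upt_Suc\<close>)
  qed (use assms in \<open>auto simp: PiE_iff\<close>)
qed

text \<open>Once the level set \<open>S\<close> is fixed, the coordinates are independent: those in
  \<open>S\<close> equal \<open>m\<close>, the others range freely over \<open>V - {m}\<close>.
  Since \<open>g\<close> sees only \<open>S\<close>, the sum of products factors coordinate by
  coordinate.\<close>

lemma sum_PiE_level_set:
  fixes w :: "'b \<Rightarrow> 'c::comm_semiring_1"
  assumes I: "finite I" and V: "finite V" "m \<in> V"
  shows "(\<Sum>d\<in>I \<rightarrow>\<^sub>E V. (\<Prod>i\<in>I. w (d i)) * g {i\<in>I. d i = m}) =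
    (\<Sum>S\<in>Pow I. w m ^ card S * (\<Sum>v\<in>V - {m}. w v) ^ (card I - card S) * g S)"
proof -
  have fin: "finite (I \<rightarrow>\<^sub>E V)" using I V by (intro finite_PiE) auto
  have "(\<Sum>d\<in>I \<rightarrow>\<^sub>E V. (\<Prod>i\<in>I. w (d i)) * g {i\<in>I. d i = m}) =
     (\<Sum>S\<in>Pow I. \<Sum>d\<in>{d\<in>I \<rightarrow>\<^sub>E V. {i\<in>I. d i = m} = S}. (\<Prod>i\<in>I. w (d i)) * g {i\<in>I. d i = m})"
    using fin I by (intro sum.group[symmetric]) auto
  also have "\<dots> = (\<Sum>S\<in>Pow I. w m ^ card S * (\<Sum>v\<in>V - {m}. w v) ^ (card I - card S) * g S)"
  proof (rule sum.cong[OF refl])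
    fix S assume S: "S \<in> Pow I"
    have level: "{d\<in>I \<rightarrow>\<^sub>E V. {i\<in>I. d i = m} = S} = PiE I (\<lambda>i. if i \<in> S then {m} else V - {m})"
      using S V by (auto simp: PiE_iff extensional_def split: if_splits)
    have "(\<Sum>d\<in>{d\<in>I \<rightarrow>\<^sub>E V. {i\<in>I. d i = m} = S}. (\<Prod>i\<in>I. w (d i)) * g {i\<in>I. d i = m}) =
        (\<Sum>d\<in>{d\<in>I \<rightarrow>\<^sub>E V. {i\<in>I. d i = m} = S}. \<Prod>i\<in>I. w (d i)) * g S"
      by (simp add: sum_distrib_right)
    also have "(\<Sum>d\<in>{d\<in>I \<rightarrow>\<^sub>E V. {i\<in>I. d i = m} = S}. \<Prod>i\<in>I. w (d i)) =
        (\<Prod>i\<in>I. \<Sum>v\<in>(if i \<in> S then {m} else V - {m}). w v)"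
      unfolding level using I V by (intro prod_sum_PiE[symmetric]) auto
    also have "\<dots> = (\<Prod>i\<in>I. if i \<in> S then w m else (\<Sum>v\<in>V - {m}. w v))"
      by (intro prod.cong) auto
    also have "\<dots> = w m ^ card S * (\<Sum>v\<in>V - {m}. w v) ^ (card I - card S)"
    proof -
      have "I \<inter> {i. i \<in> S} = S" "I \<inter> - {i. i \<in> S} = I - S" using S by auto
      then show ?thesis
        using I S by (simp add: prod.If_cases card_Diff_subset finite_subset)
    qed
    finally show "(\<Sum>d\<in>{d\<in>I \<rightarrow>\<^sub>E V. {i\<in>I. d i = m} = S}. (\<Prod>i\<in>I. w (d i)) * g {i\<in>I. d i = m}) =
      w m ^ card S * (\<Sum>v\<in>V - {m}. w v) ^ (card I - card S) * g S" .
  qed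
  finally show ?thesis .
qed

subsection \<open>Hook Schur functions\<close>

text \<open>A monomial has a single weakly increasing arrangement, so at most one index sequence
  contributes, and the coefficient tests whether \<open>S\<close> asks only for ascents of that
  arrangement.\<close>

lemma fundamental_qsym_apply:
  "fundamental_qsym n S M =
     (if size M = n \<and> 0 \<notin># M \<and>
         S \<inter> {1..n - 1} \<subseteq> {i. sorted_list_of_multiset M ! (i - 1) < sorted_list_of_multiset M ! i}
      then 1 else 0)"
proof -
  let ?b = "sorted_list_of_multiset M"
  have sorted_mset: "sorted b \<and> mset b = M \<longleftrightarrow> b = ?b" for b
    by (metis mset_sorted_list_of_multiset properties_for_sort sort_sorted_list_of_multiset_eq
        sorted_sorted_list_of_multiset)
  have len: "length ?b = size M" by (metis mset_sorted_list_of_multiset size_mset)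
  have "{b. (length b = n \<and> (\<forall>x\<in>set b. 1 \<le> x) \<and> sorted b \<and>
          (\<forall>i\<in>S \<inter> {1..n - 1}. b ! (i - 1) < b ! i)) \<and> mset b = M} =
     (if size M = n \<and> 0 \<notin># M \<and> S \<inter> {1..n - 1} \<subseteq> {i. ?b ! (i - 1) < ?b ! i} then {?b} else {})"
    (is "?L = _")
  proof -
    have "?L = {b. (sorted b \<and> mset b = M) \<and> length b = n \<and> (\<forall>x\<in>set b. 1 \<le> x) \<and>
        (\<forall>i\<in>S \<inter> {1..n - 1}. b ! (i - 1) < b ! i)}"
      by (simp only: conj_ac)
    also have "\<dots> = {b. b = ?b \<and> length b = n \<and> (\<forall>x\<in>set b. 1 \<le> x) \<and>
        (\<forall>i\<in>S \<inter> {1..n - 1}. b ! (i - 1) < b ! i)}"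
      by (simp only: sorted_mset)
    finally have "?L = \<dots>" .
    moreover have "(\<forall>x\<in>set ?b. 1 \<le> x) \<longleftrightarrow> 0 \<notin># M"
      by (metis One_nat_def Suc_le_eq gr0I less_irrefl set_sorted_list_of_multiset)
    ultimately show ?thesis by (auto simp: len)
  qed
  then show ?thesis by (simp add: fundamental_qsym_def gen_series_def)
qed

text \<open>Each value other than the least is entered at exactly one ascent, its first occurrence.
  Hence a nonempty sorted list has one ascent fewer than it has distinct values.\<close>

lemma bij_betw_ascents_sorted:
  fixes b :: "'a::linorder list"
  assumes "sorted b"
  shows "bij_betw ((!) b) {i\<in>{1..length b - 1}. b ! (i - 1) < b ! i} (set b - {Min (set b)})"
proof (cases "b = []")
  case False
  have hd: "Min (set b) = b ! 0"
    using assms False by (intro Min_eqI) (auto simp: in_set_conv_nth sorted_nth_mono)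
  show ?thesis
  proof (rule bij_betw_imageI)
    show "inj_on ((!) b) {i\<in>{1..length b - 1}. b ! (i - 1) < b ! i}"
    proof (rule linorder_inj_onI)
      fix i j assume ij: "i < j" "i \<in> {i\<in>{1..length b - 1}. b ! (i - 1) < b ! i}"
        "j \<in> {i\<in>{1..length b - 1}. b ! (i - 1) < b ! i}"
      then have "b ! i \<le> b ! (j - 1)" by (intro sorted_nth_mono assms) auto
      with ij show "b ! i \<noteq> b ! j" by auto
    qed auto
    show "(!) b ` {i\<in>{1..length b - 1}. b ! (i - 1) < b ! i} = set b - {Min (set b)}"
    proof (intro equalityI subsetI)
      fix x assume "x \<in> (!) b ` {i\<in>{1..length b - 1}. b ! (i - 1) < b ! i}"
      then obtain i where i: "i \<in> {1..length b - 1}" "b ! (i - 1) < b ! i" "x = b ! i" by auto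
      then have "b ! 0 \<le> b ! (i - 1)" by (intro sorted_nth_mono assms) auto
      with i show "x \<in> set b - {Min (set b)}" by (auto simp: hd)
    next
      fix x assume x: "x \<in> set b - {Min (set b)}"
      \<comment> \<open>The first occurrence of \<open>x\<close> is the preimage: it is not position
        0, as \<open>x\<close> is not the minimum, and its predecessor differs from
        \<open>x\<close>.\<close>
      define i where "i = (LEAST i. i < length b \<and> b ! i = x)"
      have "\<exists>i. i < length b \<and> b ! i = x" using x by (auto simp: in_set_conv_nth)
      then have i: "i < length b" "b ! i = x" unfolding i_def by (metis (mono_tags, lifting) LeastI)+
      have "i \<noteq> 0" using x i by (metis DiffE hd singletonI)
      then have "\<not> (i - 1 < length b \<and> b ! (i - 1) = x)"
        unfolding i_def by (intro not_less_Least) auto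
      then have "b ! (i - 1) \<noteq> x" using i by auto
      moreover have "b ! (i - 1) \<le> b ! i" using i by (intro sorted_nth_mono assms) auto
      ultimately show "x \<in> (!) b ` {i\<in>{1..length b - 1}. b ! (i - 1) < b ! i}"
        using i \<open>i \<noteq> 0\<close> by (intro image_eqI[of _ _ i]) auto
    qed
  qed
qed (simp add: bij_betw_def)

text \<open>A summand is 1 exactly when \<open>S\<close> lies in the ascent set \<open>D\<close> of
  the sorted arrangement, so the sum counts the \<open>k\<close>-subsets of
  \<open>D\<close>.\<close>

lemma sum_fundamental_qsym_apply:
  "(\<Sum>S | S \<subseteq> {1..n - 1} \<and> card S = k. fundamental_qsym n S M) =
     (if size M = n \<and> 0 \<notin># M then of_nat ((card (set_mset M) - 1) choose k) else (0::'a::semiring_1))"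
proof (cases "size M = n \<and> 0 \<notin># M")
  case True
  define b where "b = sorted_list_of_multiset M"
  define D where "D = {i\<in>{1..n - 1}. b ! (i - 1) < b ! i}"
  have len: "length b = n" and set: "set b = set_mset M"
    using True unfolding b_def by (metis mset_sorted_list_of_multiset size_mset, simp)
  have "card D = card (set_mset M - {Min (set_mset M)})"
    using bij_betw_same_card[OF bij_betw_ascents_sorted[of b]] unfolding D_def len set
    by (simp add: b_def)
  also have "\<dots> = card (set_mset M) - 1"
    by (cases "M = {#}") (auto simp: card_Diff_singleton)
  finally have D: "card D = card (set_mset M) - 1" .
  have "(\<Sum>S | S \<subseteq> {1..n - 1} \<and> card S = k. fundamental_qsym n S M) =
      (\<Sum>S | S \<subseteq> {1..n - 1} \<and> card S = k. if S \<subseteq> D then 1 else (0::'a))"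
    using True by (intro sum.cong) (auto simp: fundamental_qsym_apply D_def b_def)
  also have "\<dots> = of_nat (card {S. S \<subseteq> D \<and> card S = k})"
  proof -
    have "{S. S \<subseteq> {1..n - 1} \<and> card S = k} \<inter> {S. S \<subseteq> D} = {S. S \<subseteq> D \<and> card S = k}"
      by (auto simp: D_def)
    moreover have "finite {S. S \<subseteq> {1..n - 1} \<and> card S = k}"
      by (rule finite_subset[of _ "Pow {1..n - 1}"]) auto
    ultimately show ?thesis by (simp add: sum.If_cases)
  qed
  also have "card {S. S \<subseteq> D \<and> card S = k} = (card (set_mset M) - 1) choose k"
    using n_subsets[of D k] D by (simp add: D_def)
  finally show ?thesis using True by simp
next
  case False
  then show ?thesis by (auto simp: fundamental_qsym_apply intro!: sum.neutral)
qed

section \<open>Semistandard tableaux of hook shape\<close>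

lemma young_diagram_hook:
  assumes "1 \<le> i"
  shows "young_diagram (hook n i) = Pair 0 ` {0..<i} \<union> (\<lambda>r. (r, 0)) ` {1..<Suc (n - i)}"
  by (auto simp: young_diagram_def hook_def nth_Cons' less_Suc_eq_0_disj image_iff)

text \<open>The corner is read here and left out of \<open>lower_column\<close>, so that the two
  lists together read every cell of the hook once.\<close>

definition first_row :: "nat \<Rightarrow> (nat \<times> nat \<Rightarrow> nat) \<Rightarrow> nat list" where
  "first_row i T = map (\<lambda>c. T (0, c)) [0..<i]"

definition lower_column :: "nat \<Rightarrow> (nat \<times> nat \<Rightarrow> nat) \<Rightarrow> nat list" where
  "lower_column k T = map (\<lambda>r. T (r, 0)) [1..<Suc k]"

lemma weight_hook:
  assumes "1 \<le> i"
  shows "image_mset T (mset_set (young_diagram (hook n i))) =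
    mset (first_row i T) + mset (lower_column (n - i) T)"
proof -
  have "mset_set (young_diagram (hook n i)) =
      image_mset (Pair 0) (mset_set {0..<i}) + image_mset (\<lambda>r. (r, 0)) (mset_set {1..<Suc (n - i)})"
    unfolding young_diagram_hook[OF assms]
    by (subst mset_set_Union) (auto simp: image_mset_mset_set inj_on_def)
  then show ?thesis
    by (simp add: first_row_def lower_column_def multiset.map_comp comp_def
        del: upt_Suc flip: mset_upt)
qed

text \<open>Only row 0 and column 0 of a hook can contain more than one cell, so the tableau
  conditions reduce to one weakly and one strictly increasing list. The corner is put in front of
  \<open>lower_column\<close> because the strict column begins there.\<close>

lemma ssyt_hook_iff:
  assumes "1 \<le> i"
  shows "T \<in> ssyt (hook n i) \<longleftrightarrow>
    (\<forall>x\<in>set (first_row i T) \<union> set (lower_column (n - i) T). 1 \<le> x) \<and>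
    (\<forall>u. u \<notin> young_diagram (hook n i) \<longrightarrow> T u = 0) \<and>
    sorted (first_row i T) \<and> sorted_wrt (<) (T (0, 0) # lower_column (n - i) T)"
proof -
  have col: "T (0, 0) # lower_column (n - i) T = map (\<lambda>r. T (r, 0)) [0..<Suc (n - i)]"
    by (simp add: lower_column_def upt_conv_Cons del: upt_Suc)
  have "(\<forall>r c c'. c < c' \<and> (r, c') \<in> young_diagram (hook n i) \<longrightarrow> T (r, c) \<le> T (r, c')) \<longleftrightarrow>
      sorted (first_row i T)"
    by (auto simp: first_row_def sorted_wrt_iff_nth_less young_diagram_hook[OF assms] image_iff)
  moreover have "(\<forall>r r' c. r < r' \<and> (r', c) \<in> young_diagram (hook n i) \<longrightarrow> T (r, c) < T (r', c)) \<longleftrightarrow>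
      sorted_wrt (<) (T (0, 0) # lower_column (n - i) T)"
    unfolding col
    by (auto simp: sorted_wrt_iff_nth_less young_diagram_hook[OF assms] image_iff simp del: upt_Suc)
  moreover have "(\<forall>u\<in>young_diagram (hook n i). 1 \<le> T u) \<longleftrightarrow>
      (\<forall>x\<in>set (first_row i T) \<union> set (lower_column (n - i) T). 1 \<le> x)"
    by (auto simp: first_row_def lower_column_def young_diagram_hook[OF assms] simp del: upt_Suc)
  ultimately show ?thesis unfolding ssyt_def mem_Collect_eq by (simp only:)
qed

text \<open>The strict column lists its set of entries in increasing order, and the first row must
  be the rest of \<open>M\<close> in weak order. The corner is the least entry and strictly below
  the rest of the column, which is why the minimum is excluded; every other choice of
  \<open>n - i\<close> values is realised.\<close>

lemma bij_betw_ssyt_hook: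
  assumes i: "1 \<le> i" "i \<le> n" and M: "size M = n" "0 \<notin># M"
  shows "bij_betw (\<lambda>T. set (lower_column (n - i) T))
    {T\<in>ssyt (hook n i). image_mset T (mset_set (young_diagram (hook n i))) = M}
    {A. A \<subseteq> set_mset M - {Min (set_mset M)} \<and> card A = n - i}"
proof (rule bij_betw_imageI)
  let ?\<T> = "{T\<in>ssyt (hook n i). image_mset T (mset_set (young_diagram (hook n i))) = M}"
  let ?row = "first_row i" and ?col = "lower_column (n - i)"
  have tableau: "M = mset (?row T) + mset (?col T)" "sorted (?row T)" "sorted_wrt (<) (?col T)"
      "\<forall>x\<in>set (?col T). T (0, 0) < x" "\<And>u. u \<notin> young_diagram (hook n i) \<Longrightarrow> T u = 0"
    if "T \<in> ?\<T>" for T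
    using that i by (auto simp: ssyt_hook_iff weight_hook)
  show "inj_on (\<lambda>T. set (?col T)) ?\<T>"
  proof
    fix T U assume T: "T \<in> ?\<T>" and U: "U \<in> ?\<T>" and eq: "set (?col T) = set (?col U)"
    have col: "?col T = ?col U"
      using tableau(3)[OF T] tableau(3)[OF U] eq strict_sorted_equal by metis
    then have "mset (?row T) = mset (?row U)"
      using tableau(1)[OF T] tableau(1)[OF U] by simp
    then have row: "?row T = ?row U"
      using tableau(2)[OF T] tableau(2)[OF U] by (metis properties_for_sort)
    show "T = U"
    proof
      fix u
      show "T u = U u"
      proof (cases "u \<in> young_diagram (hook n i)")
        case True
        then show ?thesis
          using row col i by (auto simp: young_diagram_hook first_row_def lower_column_def simp del: upt_Suc)
      qed (simp add: tableau(5)[OF T] tableau(5)[OF U])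
    qed
  qed
  have nonempty: "M \<noteq> {#}" using i M by auto
  show "(\<lambda>T. set (?col T)) ` ?\<T> = {A. A \<subseteq> set_mset M - {Min (set_mset M)} \<and> card A = n - i}"
  proof (intro equalityI subsetI)
    fix A assume "A \<in> (\<lambda>T. set (?col T)) ` ?\<T>"
    then obtain T where T: "T \<in> ?\<T>" and A: "A = set (?col T)" by auto
    have row: "T (0, 0) \<in> set (?row T)" "\<forall>x\<in>set (?row T). T (0, 0) \<le> x"
    proof -
      show "T (0, 0) \<in> set (?row T)" using i by (auto simp: first_row_def)
      show "\<forall>x\<in>set (?row T). T (0, 0) \<le> x"
      proof
        fix x assume "x \<in> set (?row T)"
        then obtain c where "c < i" "x = T (0, c)" by (auto simp: first_row_def)
        then show "T (0, 0) \<le> x"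
          using sorted_nth_mono[OF tableau(2)[OF T], of 0 c] i by (simp add: first_row_def)
      qed
    qed
    have "set_mset M = set (?row T) \<union> set (?col T)"
      by (subst tableau(1)[OF T]) simp
    moreover from this have "Min (set_mset M) = T (0, 0)"
      using row tableau(4)[OF T] by (intro Min_eqI) (auto intro: less_imp_le)
    moreover have "card A = n - i"
      using tableau(3)[OF T] unfolding A
      by (subst distinct_card) (simp add: strict_sorted_iff, simp add: lower_column_def del: upt_Suc)
    ultimately show "A \<in> {A. A \<subseteq> set_mset M - {Min (set_mset M)} \<and> card A = n - i}"
      using tableau(4)[OF T] A by auto
  next
    fix A assume "A \<in> {A. A \<subseteq> set_mset M - {Min (set_mset M)} \<and> card A = n - i}"
    then have A: "A \<subseteq> set_mset M" "Min (set_mset M) \<notin> A" "card A = n - i" by auto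
    then have fin: "finite A" by (auto intro: finite_subset)
    \<comment> \<open>The inverse map: \<open>A\<close> goes down the column and the rest of
      \<open>M\<close> along the row, both sorted. The index \<open>r - 1\<close> appears because
      \<open>cl\<close> starts in row 1, and \<open>ssyt\<close> demands the value 0 outside the
      hook.\<close>
    define cl where "cl = sorted_list_of_set A"
    define rl where "rl = sorted_list_of_multiset (M - mset_set A)"
    define T where "T = (\<lambda>(r, c). if r = 0 \<and> c < i then rl ! c
      else if c = 0 \<and> 1 \<le> r \<and> r \<le> n - i then cl ! (r - 1) else 0)"
    have sub: "mset_set A \<subseteq># M"
      using A fin by (metis mset_set_set_mset_msubset msubset_mset_set_iff finite_set_mset
          subset_mset.order_trans)
    have len: "length cl = n - i" "length rl = i"
    proof -
      show "length cl = n - i" by (simp add: cl_def A)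
      have "length rl = size (M - mset_set A)"
        unfolding rl_def by (metis mset_sorted_list_of_multiset size_mset)
      then show "length rl = i" using sub M A i by (simp add: size_Diff_submset)
    qed
    have row: "?row T = rl"
      using len by (intro nth_equalityI) (auto simp: first_row_def T_def)
    have col: "?col T = cl"
      using len by (intro nth_equalityI) (auto simp: lower_column_def T_def simp del: upt_Suc)
    have sum: "M = mset rl + mset cl"
      using sub by (simp add: rl_def cl_def flip: sorted_list_of_mset_set)
    \<comment> \<open>Since \<open>A\<close> avoids the minimum, it stays in the row and sorting
      moves it to the corner; this makes the column strict at the corner.\<close>
    have "Min (set_mset M) \<in> set rl"
    proof -
      have "Min (set_mset M) \<in># mset rl + mset cl"
        using Min_in[of "set_mset M"] nonempty sum by simp
      moreover have "set cl = A" using fin by (simp add: cl_def)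
      ultimately show ?thesis using A by auto
    qed
    moreover have "sorted rl" by (simp add: rl_def)
    ultimately have "rl ! 0 \<le> Min (set_mset M)"
      by (metis in_set_conv_nth le0 sorted_nth_mono)
    moreover have "Min (set_mset M) < x" if "x \<in> set cl" for x
    proof -
      have "x \<in> A" using that fin by (simp add: cl_def)
      then have "Min (set_mset M) \<le> x" "x \<noteq> Min (set_mset M)"
        using A by auto
      then show ?thesis by simp
    qed
    moreover have "T (0, 0) = rl ! 0" using i by (simp add: T_def)
    ultimately have "sorted_wrt (<) (T (0, 0) # cl)"
      by (auto simp: cl_def intro: le_less_trans)
    moreover have "\<forall>x\<in>set rl \<union> set cl. 1 \<le> x"
    proof
      fix x assume "x \<in> set rl \<union> set cl"
      then have "x \<in># M" by (subst sum) auto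
      then show "1 \<le> x" using M by (cases x) auto
    qed
    moreover have "T u = 0" if "u \<notin> young_diagram (hook n i)" for u
      using that i by (cases u) (auto simp: T_def young_diagram_hook image_iff)
    ultimately have "T \<in> ssyt (hook n i)"
      unfolding ssyt_hook_iff[OF i(1)] row col using \<open>sorted rl\<close> by blast
    moreover have "image_mset T (mset_set (young_diagram (hook n i))) = M"
      unfolding weight_hook[OF i(1)] row col by (rule sum[symmetric])
    ultimately have "T \<in> ?\<T>" by blast
    moreover have "A = set (?col T)" unfolding col using fin by (simp add: cl_def)
    ultimately show "A \<in> (\<lambda>T. set (?col T)) ` ?\<T>" by blast
  qed
qed

text \<open>The bijection counts tableaux by subsets of size \<open>n - i\<close> of the non-minimal
  values, giving the same binomial as \<open>sum_fundamental_qsym_apply\<close> with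
  \<open>k = n - i\<close>.\<close>

lemma schur_hook_apply:
  assumes i: "1 \<le> i" "i \<le> n"
  shows "schur (hook n i) M =
    (if size M = n \<and> 0 \<notin># M then of_nat ((card (set_mset M) - 1) choose (n - i))
     else (0::'a::semiring_1))"
proof (cases "size M = n \<and> 0 \<notin># M")
  case True
  then have "M \<noteq> {#}" using i by auto
  then have "card (set_mset M - {Min (set_mset M)}) = card (set_mset M) - 1"
    by (simp add: card_Diff_singleton)
  then show ?thesis
    using bij_betw_same_card[OF bij_betw_ssyt_hook[of i n M]] True i
      n_subsets[of "set_mset M - {Min (set_mset M)}" "n - i"]
    by (simp add: schur_def gen_series_def)
next
  case False
  \<comment> \<open>Every tableau weight has size \<open>n\<close> and only positive indices, so no
    tableau has weight \<open>M\<close>.\<close>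
  have "image_mset T (mset_set (young_diagram (hook n i))) \<noteq> M" if T: "T \<in> ssyt (hook n i)" for T
  proof
    assume "image_mset T (mset_set (young_diagram (hook n i))) = M"
    then have M: "M = mset (first_row i T) + mset (lower_column (n - i) T)"
      using i by (simp add: weight_hook)
    have "size M = n" using i by (simp add: M first_row_def lower_column_def del: upt_Suc)
    moreover have "\<forall>x\<in>#M. 1 \<le> x"
      using T i by (auto simp: M ssyt_hook_iff)
    ultimately show False using False by force
  qed
  then have empty: "{T\<in>ssyt (hook n i). image_mset T (mset_set (young_diagram (hook n i))) = M} = {}"
    by blast
  show ?thesis unfolding schur_def gen_series_def empty using False by auto
qed

subsection \<open>The generating functions\<close>

lemma sum_series_apply: "(\<Sum>x\<in>A. f x) M = (\<Sum>x\<in>A. f x (M::nat multiset))"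
  by (induction A rule: infinite_finite_induct) auto

text \<open>The weights depend on \<open>S\<close> only through its size, so grouping by
  \<open>i = n - card S\<close> leaves for each \<open>i\<close> a sum of fundamentals with the same
  coefficients as the hook Schur function.\<close>

lemma sum_Pow_fundamental_qsym_eq_sum_schur_hook:
  fixes \<alpha> \<beta> :: "'a::comm_semiring_1"
  assumes "n \<ge> 1"
  shows "(\<Sum>S\<in>Pow {1..n - 1}. \<alpha> ^ card S * \<beta> ^ (n - 1 - card S) * fundamental_qsym n S M) =
    (\<Sum>i=1..n. \<alpha> ^ (n - i) * \<beta> ^ (i - 1) * schur (hook n i) M)"
proof -
  have card_less: "card S < n" if "S \<subseteq> {1..n - 1}" for S
    using card_mono[OF _ that] assms by simp
  have "(\<Sum>S\<in>Pow {1..n - 1}. \<alpha> ^ card S * \<beta> ^ (n - 1 - card S) * fundamental_qsym n S M) =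
     (\<Sum>i=1..n. \<Sum>S\<in>{S\<in>Pow {1..n - 1}. n - card S = i}.
        \<alpha> ^ card S * \<beta> ^ (n - 1 - card S) * fundamental_qsym n S M)"
  proof (intro sum.group[symmetric] image_subsetI)
    fix S assume "S \<in> Pow {1..n - 1}"
    then show "n - card S \<in> {1..n}" using card_less[of S] by auto
  qed auto
  also have "\<dots> = (\<Sum>i=1..n. \<alpha> ^ (n - i) * \<beta> ^ (i - 1) * schur (hook n i) M)"
  proof (rule sum.cong[OF refl])
    fix i assume i: "i \<in> {1..n}"
    have "{S\<in>Pow {1..n - 1}. n - card S = i} = {S. S \<subseteq> {1..n - 1} \<and> card S = n - i}"
    proof (rule Collect_cong)
      show "S \<in> Pow {1..n - 1} \<and> n - card S = i \<longleftrightarrow> S \<subseteq> {1..n - 1} \<and> card S = n - i" for S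
        using i card_less[of S] by auto
    qed
    moreover have "n - 1 - (n - i) = i - 1" using i by auto
    ultimately have "(\<Sum>S\<in>{S\<in>Pow {1..n - 1}. n - card S = i}.
        \<alpha> ^ card S * \<beta> ^ (n - 1 - card S) * fundamental_qsym n S M) =
        (\<Sum>S | S \<subseteq> {1..n - 1} \<and> card S = n - i. \<alpha> ^ (n - i) * \<beta> ^ (i - 1) * fundamental_qsym n S M)"
      by (intro sum.cong) auto
    also have "\<dots> = \<alpha> ^ (n - i) * \<beta> ^ (i - 1) * schur (hook n i) M"
      unfolding sum_distrib_left[symmetric] sum_fundamental_qsym_apply
      using i by (simp add: schur_hook_apply)
    finally show "(\<Sum>S\<in>{S\<in>Pow {1..n - 1}. n - card S = i}.
        \<alpha> ^ card S * \<beta> ^ (n - 1 - card S) * fundamental_qsym n S M) =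
        \<alpha> ^ (n - i) * \<beta> ^ (i - 1) * schur (hook n i) M" .
  qed
  finally show ?thesis .
qed

text \<open>Giving each difference the weight \<open>w\<close> turns the power of \<open>q\<close>
  into a product over positions, which the bijection with difference vectors makes a sum over
  independent coordinates. As \<open>m = l\<close> is allowed, both identities of the theorem are
  instances.\<close>

lemma sum_PPF_fundamental_qsym:
  fixes n :: nat and m l :: int and q :: "'a::comm_semiring_1"
  assumes n: "n \<ge> 2" and m: "0 \<le> m" "m \<le> int n - 2" and l: "0 \<le> l" "l \<le> int n - 2"
  defines "w \<equiv> \<lambda>v. if v = l then q else 1"
  shows "(\<Sum>\<pi>\<in>PPF n. q ^ fdiff l \<pi> *\<^sub>S fundamental_qsym n (fdiff_set m \<pi>)) =
    (\<Sum>i=1..n. (w m ^ (n - i) * (\<Sum>v\<in>{0..<int n - 1} - {m}. w v) ^ (i - 1)) *\<^sub>S schur (hook n i))"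
proof
  fix M
  define N where "N = n - 1"
  have N: "N > 0" "n = Suc N" "int n - 1 = int N" using n by (auto simp: N_def)
  let ?\<delta> = "\<lambda>xs. \<lambda>i\<in>{1..N}. (int (xs ! i) - int (xs ! (i - 1))) mod int N"
  have set: "fdiff_set k \<pi> = {i\<in>{1..N}. ?\<delta> \<pi> i = k}"
    if "\<pi> \<in> PPF n" "0 \<le> k" "k \<le> int n - 2" for \<pi> k
  proof -
    have len: "length \<pi> = Suc N" using that n N by (simp add: PPF_iff_length_filter)
    \<comment> \<open>As \<open>k\<close> is already reduced, congruence to \<open>k\<close> means
      equality with \<open>k\<close> after reduction.\<close>
    have "k mod int N = k" using that N by simp
    then show ?thesis unfolding fdiff_set_def len by (auto simp: cong_def)
  qed
  have "(\<Sum>\<pi>\<in>PPF n. q ^ fdiff l \<pi> *\<^sub>S fundamental_qsym n (fdiff_set m \<pi>)) M =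
      (\<Sum>\<pi>\<in>PPF n. (\<Prod>i\<in>{1..N}. w (?\<delta> \<pi> i)) * fundamental_qsym n {i\<in>{1..N}. ?\<delta> \<pi> i = m} M)"
    unfolding sum_series_apply scale_def
  proof (rule sum.cong[OF refl])
    fix \<pi> assume \<pi>: "\<pi> \<in> PPF n"
    have "(\<Prod>i\<in>{1..N}. w (d i)) = q ^ card {i\<in>{1..N}. d i = l}" for d :: "nat \<Rightarrow> int"
      by (simp add: w_def prod.If_cases Int_def)
    from this[of "?\<delta> \<pi>"] show "q ^ fdiff l \<pi> * fundamental_qsym n (fdiff_set m \<pi>) M =
        (\<Prod>i\<in>{1..N}. w (?\<delta> \<pi> i)) * fundamental_qsym n {i\<in>{1..N}. ?\<delta> \<pi> i = m} M"
      unfolding fdiff_def set[OF \<pi> m] set[OF \<pi> l] by (simp only:)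
  qed
  also have "\<dots> = (\<Sum>d\<in>{1..N} \<rightarrow>\<^sub>E {0..<int N}.
      (\<Prod>i\<in>{1..N}. w (d i)) * fundamental_qsym n {i\<in>{1..N}. d i = m} M)"
    using sum.reindex_bij_betw[OF bij_betw_PPF_differences[OF N(1)],
      of "\<lambda>d. (\<Prod>i\<in>{1..N}. w (d i)) * fundamental_qsym n {i\<in>{1..N}. d i = m} M"]
    unfolding N(2) .
  also have "\<dots> = (\<Sum>S\<in>Pow {1..N}. w m ^ card S *
      (\<Sum>v\<in>{0..<int N} - {m}. w v) ^ (card {1..N} - card S) * fundamental_qsym n S M)"
    using m N by (intro sum_PiE_level_set) auto
  also have "\<dots> = (\<Sum>i=1..n. w m ^ (n - i) *
      (\<Sum>v\<in>{0..<int N} - {m}. w v) ^ (i - 1) * schur (hook n i) M)"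
    using sum_Pow_fundamental_qsym_eq_sum_schur_hook[of n "w m" "\<Sum>v\<in>{0..<int N} - {m}. w v" M] n
    by (simp add: N_def)
  finally show "(\<Sum>\<pi>\<in>PPF n. q ^ fdiff l \<pi> *\<^sub>S fundamental_qsym n (fdiff_set m \<pi>)) M =
    (\<Sum>i=1..n. (w m ^ (n - i) * (\<Sum>v\<in>{0..<int n - 1} - {m}. w v) ^ (i - 1)) *\<^sub>S schur (hook n i)) M"
    unfolding sum_series_apply scale_def N(3) .
qed

theorem theorem1p6:
  fixes n :: nat and m l :: int
  assumes "m \<noteq> l" and "0 \<le> m" "m \<le> int n - 2" and "0 \<le> l" "l \<le> int n - 2"
  shows "(\<Sum>\<pi>\<in>PPF n. qvar ^ fdiff l \<pi> *\<^sub>S fundamental_qsym n (fdiff_set l \<pi>)) =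
           (\<Sum>i=1..n. (qvar ^ (n - i) * (of_nat n - 2) ^ (i - 1)) *\<^sub>S schur (hook n i)) \<and>
         (\<Sum>\<pi>\<in>PPF n. qvar ^ fdiff l \<pi> *\<^sub>S fundamental_qsym n (fdiff_set m \<pi>)) =
           (\<Sum>i=1..n. (qvar + of_nat n - 3) ^ (i - 1) *\<^sub>S schur (hook n i))"
proof -
  \<comment> \<open>Two distinct values between 0 and \<open>n - 2\<close> need
    \<open>n \<ge> 3\<close>, so the natural differences \<open>n - 2\<close> and
    \<open>n - 3\<close> are not truncated.\<close>
  have n: "n \<ge> 3" using assms by linarith
  let ?V = "{0..<int n - 1}"
  let ?w = "\<lambda>v. if v = l then qvar else 1"
  have card1: "card (?V - {l}) = n - 2" using assms by (simp add: card_Diff_singleton)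
  have "(\<Sum>v\<in>?V - {l}. ?w v) = of_nat (n - 2)"
    by (subst card1[symmetric]) simp
  then have 1: "(\<Sum>v\<in>?V - {l}. ?w v) = of_nat n - 2" using n by (simp add: of_nat_diff)
  have l: "l \<in> ?V - {m}" using assms by auto
  \<comment> \<open>With \<open>m\<close> removed, \<open>l\<close> contributes \<open>qvar\<close>
    and the \<open>n - 3\<close> other residues contribute 1 each.\<close>
  have card2: "card (?V - {m} - {l}) = n - 3"
    using assms l by (subst card_Diff_singleton) (auto simp: card_Diff_singleton)
  have "(\<Sum>v\<in>?V - {m}. ?w v) = qvar + (\<Sum>v\<in>?V - {m} - {l}. ?w v)"
    using l by (subst sum.remove[of _ l]) auto
  also have "(\<Sum>v\<in>?V - {m} - {l}. ?w v) = of_nat (n - 3)"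
    by (subst card2[symmetric]) simp
  finally have 2: "(\<Sum>v\<in>?V - {m}. ?w v) = qvar + of_nat n - 3" using n by (simp add: of_nat_diff)
  \<comment> \<open>In the first instance the distinguished residue has weight \<open>qvar\<close>;
    in the second its weight is 1, so only the power of the residue sum remains.\<close>
  from sum_PPF_fundamental_qsym[of n l l qvar] sum_PPF_fundamental_qsym[of n m l qvar]
  show ?thesis unfolding 1 2 using assms n by simp
qed

end
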